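(* Let $X$ be an infinite-dimensional complex Hilbert space and let $A\in\mathcal{B}(X)$ be generalized Drazin invertible. The system of conditions $$AB=P_{R(A^d),\,N(A^{\mathrm{cEP}}A)}\quad\text{and}\quad R(B)\subseteq R(A^d)$$ in the unknown $B\in\mathcal{B}(X)$ is consistent and it has the unique solution $B=(A^{\mathrm{cEP}})^2A$.
   Context: $\mathcal{B}(X)$ is the set of bounded linear operators on $X$; $R(\cdot)$, $N(\cdot)$ denote range and null space; $P_L$ is the orthogonal projector onto a closed subspace $L$; $P_{L,M}$ is the idempotent with range $L$ and null space $M$. $A\in\mathcal{B}(X)$ is generalized Drazin invertible if there is a (necessarily unique) $A^d\in\mathcal{B}(X)$ with $AA^d=A^dA$, $A^dAA^d=A^d$ and $A-A^2A^d$ quasinilpotent. The core-EP inverse $A^{\mathrm{cEP}}$ of such $A$ is the unique (it exists) operator $B\in\mathcal{B}(X)$ with $AB=P_{R(A^d)}$ and $R(B)\subseteq R(A^d)$. *)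

theory Defs
  imports "HOL-Analysis.Analysis"
begin

(* Complex Hilbert spaces, as complete real inner product spaces with a compatible complex
   structure.  The complex inner product is linear in its first argument.  Since the
   underlying real inner product is Re (cinner x y), and cinner x x is real by conjugate
   symmetry, cinner x x = of_real ((norm x)^2); in particular cinner is positive definite and
   the norm and topology are the ones it induces. *)
class complex_hilbert_space = real_inner + banach +
  fixes scaleC :: "complex \<Rightarrow> 'a \<Rightarrow> 'a"  (infixr \<open>*\<^sub>C\<close> 75)
    and cinner :: "'a \<Rightarrow> 'a \<Rightarrow> complex"
  assumes scaleC_add_right: "a *\<^sub>C (x + y) = a *\<^sub>C x + a *\<^sub>C y"
    and scaleC_add_left: "(a + b) *\<^sub>C x = a *\<^sub>C x + b *\<^sub>C x"
    and scaleC_scaleC: "a *\<^sub>C (b *\<^sub>C x) = (a * b) *\<^sub>C x"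
    and scaleR_scaleC: "r *\<^sub>R x = complex_of_real r *\<^sub>C x"
    and cinner_commute: "cinner x y = cnj (cinner y x)"
    and cinner_add_left: "cinner (x + y) z = cinner x z + cinner y z"
    and cinner_scaleC_left: "cinner (a *\<^sub>C x) y = a * cinner x y"
    and inner_eq_Re_cinner: "inner x y = Re (cinner x y)"

lemma vector_space_scaleC:
  "vector_space (scaleC :: complex \<Rightarrow> 'a \<Rightarrow> 'a::complex_hilbert_space)"
proof
  show "1 *\<^sub>C x = x" for x :: 'a
    using scaleR_scaleC[of 1 x] by simp
qed (simp_all add: scaleC_add_right scaleC_add_left scaleC_scaleC)

definition infinite_dimensional :: "'a::complex_hilbert_space itself \<Rightarrow> bool" where
  "infinite_dimensional _ \<longleftrightarrow> \<not> (\<exists>S::'a set. finite S \<and> module.span scaleC S = UNIV)"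

definition bounded_ops :: "('a::complex_hilbert_space \<Rightarrow> 'a) set" where
  "bounded_ops = {T. bounded_linear T \<and> (\<forall>c x. T (c *\<^sub>C x) = c *\<^sub>C T x)}"

definition null_space :: "('a::complex_hilbert_space \<Rightarrow> 'a) \<Rightarrow> 'a set" where
  "null_space T = {x. T x = 0}"

definition spectrum :: "('a::complex_hilbert_space \<Rightarrow> 'a) \<Rightarrow> complex set" where
  "spectrum T = {l. \<not> (\<exists>S \<in> bounded_ops.
     S \<circ> (\<lambda>x. l *\<^sub>C x - T x) = id \<and> (\<lambda>x. l *\<^sub>C x - T x) \<circ> S = id)}"

definition quasinilpotent :: "('a::complex_hilbert_space \<Rightarrow> 'a) \<Rightarrow> bool" where
  "quasinilpotent T \<longleftrightarrow> T \<in> bounded_ops \<and> spectrum T = {0}"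

(* The projectors are definite descriptions, hence only meaningful when the projector exists:
   for orth_projector L, when L is a closed subspace; for projector L M, when L and M are
   closed complementary subspaces.  There is at most one such operator in each case. *)
definition orth_projector :: "'a::complex_hilbert_space set \<Rightarrow> 'a \<Rightarrow> 'a" where
  "orth_projector L = (THE P. P \<in> bounded_ops \<and> P \<circ> P = P \<and> range P = L \<and>
     (\<forall>x y. cinner (P x) y = cinner x (P y)))"

definition projector :: "'a::complex_hilbert_space set \<Rightarrow> 'a set \<Rightarrow> 'a \<Rightarrow> 'a" where
  "projector L M = (THE P. P \<in> bounded_ops \<and> P \<circ> P = P \<and> range P = L \<and> null_space P = M)"

definition is_gdrazin_inverse ::
    "('a::complex_hilbert_space \<Rightarrow> 'a) \<Rightarrow> ('a \<Rightarrow> 'a) \<Rightarrow> bool" where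
  "is_gdrazin_inverse A D \<longleftrightarrow> D \<in> bounded_ops \<and> A \<circ> D = D \<circ> A \<and> D \<circ> A \<circ> D = D \<and>
     quasinilpotent (\<lambda>x. A x - (A \<circ> A \<circ> D) x)"

definition gdrazin_invertible :: "('a::complex_hilbert_space \<Rightarrow> 'a) \<Rightarrow> bool" where
  "gdrazin_invertible A \<longleftrightarrow> (\<exists>D. is_gdrazin_inverse A D)"

definition gdrazin_inverse :: "('a::complex_hilbert_space \<Rightarrow> 'a) \<Rightarrow> 'a \<Rightarrow> 'a" where
  "gdrazin_inverse A = (THE D. is_gdrazin_inverse A D)"

definition core_ep_inverse :: "('a::complex_hilbert_space \<Rightarrow> 'a) \<Rightarrow> 'a \<Rightarrow> 'a" where
  "core_ep_inverse A = (THE B. B \<in> bounded_ops \<and>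
     A \<circ> B = orth_projector (range (gdrazin_inverse A)) \<and>
     range B \<subseteq> range (gdrazin_inverse A))"

end

theory Submission
  imports Defs "HOL-Complex_Analysis.Cauchy_Integral_Formula"
begin

text \<open>
  Write \<open>D\<close> for a generalized Drazin inverse of \<open>A\<close>, \<open>L\<close> for its range and \<open>E\<close> for the core-EP
  inverse. On \<open>L\<close> the idempotent \<open>AD = DA\<close> is the identity, so an operator \<open>B\<close> with range in \<open>L\<close>
  is recovered from \<open>AB\<close> as \<open>B = D(AB)\<close>; hence \<open>E = D P\<^sub>L\<close>. The operator \<open>EA\<close> is idempotent with
  range \<open>L\<close>, so it is the projector in the statement, and \<open>A E\<^sup>2 A = P\<^sub>L E A = E A\<close>.

  The analytic part is the uniqueness of \<open>D\<close>. If \<open>D'\<close> is another candidate and \<open>Q\<close> the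
  quasinilpotent part belonging to \<open>D'\<close>, then \<open>T = AD (1 - AD')\<close> satisfies \<open>T = D T Q\<close>, and
  \<open>T = (1 - AD') AD\<close> satisfies \<open>T = Q T D\<close>. Either equation makes the entire function
  \<open>T (1 - zQ)\<^sup>-\<^sup>1\<close>, respectively \<open>(1 - zQ)\<^sup>-\<^sup>1 T\<close>, vanish at infinity, so \<open>T = 0\<close> by Liouville.
\<close>

section \<open>Bounded operators on a complex Hilbert space\<close>

lemma scaleC_zero_left [simp]: "0 *\<^sub>C (x::'a::complex_hilbert_space) = 0"
  using scaleC_add_left[of 0 0 x] by simp

lemma scaleC_one [simp]: "1 *\<^sub>C (x::'a::complex_hilbert_space) = x"
  using scaleR_scaleC[of 1 x] by simp

lemma scaleC_diff_right: "c *\<^sub>C (x - y) = c *\<^sub>C x - c *\<^sub>C (y::'a::complex_hilbert_space)"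
  using scaleC_add_right[of c "x - y" y] by (simp add: algebra_simps)

lemma scaleC_diff_left: "(a - b) *\<^sub>C x = a *\<^sub>C x - b *\<^sub>C (x::'a::complex_hilbert_space)"
  using scaleC_add_left[of "a - b" b x] by (simp add: algebra_simps)

lemma cinner_scaleC_right: "cinner x (c *\<^sub>C y) = cnj c * cinner x (y::'a::complex_hilbert_space)"
  by (metis cinner_commute cinner_scaleC_left complex_cnj_mult)

text \<open>Conjugate-linearity in the second argument turns the real part of
  \<open>cinner x (\<i> *\<^sub>C y)\<close> into the imaginary part of \<open>cinner x y\<close>.
  Real Cauchy-Schwarz and real orthogonality thereby carry over to \<open>cinner\<close>.\<close>

lemma cinner_eq_inner:
  "cinner x y = Complex (inner x y) (inner x (\<i> *\<^sub>C (y::'a::complex_hilbert_space)))"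
  by (simp add: complex_eq_iff inner_eq_Re_cinner cinner_scaleC_right)

lemma cinner_self: "cinner x x = complex_of_real ((norm (x::'a::complex_hilbert_space))\<^sup>2)"
proof -
  have "Im (cinner x x) = 0"
    using arg_cong[OF cinner_commute[of x x], of Im] by simp
  moreover have "Re (cinner x x) = (norm x)\<^sup>2"
    by (simp add: inner_eq_Re_cinner[symmetric] power2_norm_eq_inner)
  ultimately show ?thesis
    by (simp add: complex_eq_iff)
qed

lemma cinner_diff_left: "cinner (x - y) z = cinner x z - cinner y (z::'a::complex_hilbert_space)"
  using cinner_add_left[of "x - y" y z] by simp

lemma cinner_eqI:
  fixes x y :: "'a::complex_hilbert_space"
  assumes "\<And>z. cinner x z = cinner y z"
  shows "x = y"
proof -
  have "inner x z = inner y z" for z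
    using assms by (simp add: inner_eq_Re_cinner)
  then have "inner (x - y) (x - y) = 0"
    by (simp add: inner_diff_left)
  then show ?thesis
    by simp
qed

lemma norm_scaleC: "norm (c *\<^sub>C x) = cmod c * norm (x::'a::complex_hilbert_space)"
proof -
  have "complex_of_real ((norm (c *\<^sub>C x))\<^sup>2) = c * cnj c * complex_of_real ((norm x)\<^sup>2)"
    by (simp only: cinner_self[symmetric] cinner_scaleC_left cinner_scaleC_right mult_ac)
  also have "\<dots> = complex_of_real ((cmod c * norm x)\<^sup>2)"
    by (simp only: complex_norm_square[symmetric] power_mult_distrib of_real_mult)
  finally have "(norm (c *\<^sub>C x))\<^sup>2 = (cmod c * norm x)\<^sup>2"
    by (simp only: of_real_eq_iff)
  then show ?thesis
    by (simp add: power2_eq_iff_nonneg)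
qed

lemma bounded_linear_cinner_left:
  "bounded_linear (\<lambda>x. cinner x (y::'a::complex_hilbert_space))"
proof (rule bounded_linear_intro[where K = "2 * norm y"])
  show "cinner (a + b) y = cinner a y + cinner b y" for a b
    by (rule cinner_add_left)
  show "cinner (r *\<^sub>R a) y = r *\<^sub>R cinner a y" for r a
    by (simp add: scaleR_scaleC cinner_scaleC_left scaleR_conv_of_real)
  show "norm (cinner x y) \<le> norm x * (2 * norm y)" for x
  proof -
    have "norm (cinner x y) \<le> \<bar>inner x y\<bar> + \<bar>inner x (\<i> *\<^sub>C y)\<bar>"
      using cmod_le[of "cinner x y"] by (simp add: cinner_eq_inner)
    moreover have "\<bar>inner x y\<bar> \<le> norm x * norm y"
      by (rule Cauchy_Schwarz_ineq2)
    moreover have "\<bar>inner x (\<i> *\<^sub>C y)\<bar> \<le> norm x * norm y"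
      using Cauchy_Schwarz_ineq2[of x "\<i> *\<^sub>C y"] by (simp add: norm_scaleC)
    ultimately show ?thesis
      by simp
  qed
qed

lemma bounded_opsI:
  assumes "\<And>x y. T (x + y) = T x + T y" "\<And>c x. T (c *\<^sub>C x) = c *\<^sub>C T x"
    and "\<And>x. norm (T x) \<le> norm x * K"
  shows "T \<in> bounded_ops"
proof -
  have "bounded_linear T"
    by (rule bounded_linear_intro[where K = K]) (use assms in \<open>auto simp: scaleR_scaleC\<close>)
  then show ?thesis
    using assms by (simp add: bounded_ops_def)
qed

lemma bounded_ops_linear: "T \<in> bounded_ops \<Longrightarrow> bounded_linear T"
  by (simp add: bounded_ops_def)

lemma bounded_ops_scaleC: "T \<in> bounded_ops \<Longrightarrow> T (c *\<^sub>C x) = c *\<^sub>C T x"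
  by (simp add: bounded_ops_def)

lemma bounded_ops_diff: "T \<in> bounded_ops \<Longrightarrow> T (x - y) = T x - T y"
  by (simp add: bounded_ops_def linear_diff bounded_linear.linear)

lemma bounded_ops_add: "T \<in> bounded_ops \<Longrightarrow> T (x + y) = T x + T y"
  by (simp add: bounded_ops_def linear_add bounded_linear.linear)

lemma bounded_ops_zero: "T \<in> bounded_ops \<Longrightarrow> T 0 = 0"
  by (simp add: bounded_ops_def linear_0 bounded_linear.linear)

lemma bounded_ops_norm_bound: "T \<in> bounded_ops \<Longrightarrow> norm (T x) \<le> onorm T * norm x"
  by (simp add: bounded_ops_linear onorm)

lemma bounded_ops_comp:
  "S \<in> bounded_ops \<Longrightarrow> T \<in> bounded_ops \<Longrightarrow> (\<lambda>x. S (T x)) \<in> bounded_ops"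
  by (simp add: bounded_ops_def bounded_linear_compose)

lemma bounded_ops_sub:
  "S \<in> bounded_ops \<Longrightarrow> T \<in> bounded_ops \<Longrightarrow> (\<lambda>x. S x - T x) \<in> bounded_ops"
  by (simp add: bounded_ops_def bounded_linear_sub scaleC_diff_right)

lemma bounded_ops_scale:
  assumes "T \<in> bounded_ops"
  shows "(\<lambda>x. c *\<^sub>C T x) \<in> bounded_ops"
proof (rule bounded_opsI[where K = "cmod c * onorm T"])
  show "norm (c *\<^sub>C T x) \<le> norm x * (cmod c * onorm T)" for x
    using mult_left_mono[OF bounded_ops_norm_bound[OF assms, of x], of "cmod c"]
    by (simp add: norm_scaleC mult_ac)
qed (simp_all add: assms bounded_ops_add bounded_ops_scaleC scaleC_add_right scaleC_scaleC mult_ac)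

lemma bounded_ops_id: "(\<lambda>x. x) \<in> bounded_ops"
  by (simp add: bounded_ops_def)

section \<open>Resolvents of quasinilpotent operators\<close>

text \<open>\<open>R z\<close> is the inverse of 1 - zQ. For nonzero \<open>z\<close> it is 1/z
  times the inverse of 1/z - Q, which exists because the spectrum is {0}. Taking 1/z as spectral
  parameter yields a family defined on the whole plane.\<close>

lemma quasinilpotent_resolvent:
  assumes "quasinilpotent Q"
  obtains R where "\<And>z. R z \<in> bounded_ops"
    and "\<And>z x. R z (x - z *\<^sub>C Q x) = x" and "\<And>z x. R z x - z *\<^sub>C Q (R z x) = x"
proof -
  have Q: "Q \<in> bounded_ops"
    using assms by (simp add: quasinilpotent_def)
  have "\<exists>S\<in>bounded_ops. (\<forall>x. S (x - z *\<^sub>C Q x) = x) \<and> (\<forall>x. S x - z *\<^sub>C Q (S x) = x)" for z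
  proof (cases "z = 0")
    case True
    then show ?thesis
      by (intro bexI[OF _ bounded_ops_id]) simp
  next
    case False
    then have "1 / z \<notin> spectrum Q"
      using assms by (simp add: quasinilpotent_def)
    then obtain S where S: "S \<in> bounded_ops"
      and l: "\<And>x. S ((1 / z) *\<^sub>C x - Q x) = x" and r: "\<And>x. (1 / z) *\<^sub>C S x - Q (S x) = x"
      unfolding spectrum_def by (auto simp: fun_eq_iff)
    have eq: "(1 / z) *\<^sub>C (x - z *\<^sub>C Q x) = (1 / z) *\<^sub>C x - Q x" for x
      using False by (simp add: scaleC_diff_right scaleC_scaleC)
    show ?thesis
    proof (intro bexI conjI allI)
      show "(1 / z) *\<^sub>C S (x - z *\<^sub>C Q x) = x" for x
        by (metis S bounded_ops_scaleC eq l)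
      show "(1 / z) *\<^sub>C S x - z *\<^sub>C Q ((1 / z) *\<^sub>C S x) = x" for x
        using r[of x] False by (simp add: bounded_ops_scaleC[OF Q] scaleC_scaleC)
      show "(\<lambda>x. (1 / z) *\<^sub>C S x) \<in> bounded_ops"
        by (rule bounded_ops_scale[OF S])
    qed
  qed
  then show ?thesis
    using that by metis
qed

text \<open>Apply \<open>R w\<close> to v = (1 - zQ) \<open>R z v\<close> and split 1 - zQ = (1 -
  wQ) - (z - w)Q.\<close>

lemma resolvent_identity:
  assumes R: "\<And>z. R z \<in> bounded_ops"
    and l: "\<And>z x. R z (x - z *\<^sub>C Q x) = x" and r: "\<And>z x. R z x - z *\<^sub>C Q (R z x) = x"
  shows "R z v - R w v = (z - w) *\<^sub>C R w (Q (R z v))"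
proof -
  have "R w v = R w (R z v - z *\<^sub>C Q (R z v))"
    by (simp add: r)
  also have "\<dots> = R w ((R z v - w *\<^sub>C Q (R z v)) - (z - w) *\<^sub>C Q (R z v))"
    by (simp add: scaleC_diff_left)
  also have "\<dots> = R z v - (z - w) *\<^sub>C R w (Q (R z v))"
    by (simp only: bounded_ops_diff[OF R, of w "R z v - w *\<^sub>C Q (R z v)"] bounded_ops_scaleC[OF R] l)
  finally show ?thesis
    by simp
qed

text \<open>The resolvent identity bounds the increment by a multiple of
  \<open>norm (R z v)\<close>, which is not known in advance to stay bounded near \<open>w\<close>.
  Once \<open>cmod (z - w) * K\<close> is below 1/2, the triangle inequality absorbs that term and
  gives the local bound \<open>2 * norm (R w v)\<close>.\<close>

lemma resolvent_tendsto:
  assumes R: "\<And>z. R z \<in> bounded_ops" and Q: "Q \<in> bounded_ops"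
    and l: "\<And>z x. R z (x - z *\<^sub>C Q x) = x" and r: "\<And>z x. R z x - z *\<^sub>C Q (R z x) = x"
  shows "((\<lambda>z. R z v) \<longlongrightarrow> R w v) (at w)"
proof -
  define K where "K = onorm (\<lambda>x. R w (Q x))"
  have RQ: "(\<lambda>x. R w (Q x)) \<in> bounded_ops"
    by (rule bounded_ops_comp[OF R Q])
  have K0: "0 \<le> K"
    unfolding K_def by (rule onorm_pos_le[OF bounded_ops_linear[OF RQ]])
  have diff: "norm (R z v - R w v) \<le> cmod (z - w) * (K * norm (R z v))" for z
    unfolding resolvent_identity[where R = R, OF R l r] norm_scaleC
    by (rule mult_left_mono) (use bounded_ops_norm_bound[OF RQ] K_def in auto)
  have lim: "((\<lambda>z. cmod (z - w) * K) \<longlongrightarrow> 0) (at w)"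
    by (auto intro!: tendsto_eq_intros)
  have "\<forall>\<^sub>F z in at w. cmod (z - w) * K < 1 / 2"
    by (rule order_tendstoD(2)[OF lim]) simp
  then have ev: "\<forall>\<^sub>F z in at w. norm (R z v - R w v) \<le> cmod (z - w) * K * (2 * norm (R w v))"
  proof eventually_elim
    case (elim z)
    have "norm (R z v) \<le> norm (R w v) + norm (R z v - R w v)"
      by (rule norm_triangle_sub)
    also have "\<dots> \<le> norm (R w v) + cmod (z - w) * K * norm (R z v)"
      using diff[of z] by (simp add: mult.assoc)
    also have "\<dots> \<le> norm (R w v) + 1 / 2 * norm (R z v)"
      using elim by (intro add_left_mono mult_right_mono) auto
    finally have "norm (R z v) \<le> 2 * norm (R w v)"
      by simp
    then have "cmod (z - w) * K * norm (R z v) \<le> cmod (z - w) * K * (2 * norm (R w v))"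
      using K0 by (intro mult_left_mono) auto
    then show ?case
      using diff[of z] by (simp add: mult.assoc)
  qed
  have "((\<lambda>z. R z v - R w v) \<longlongrightarrow> 0) (at w)"
    by (rule Lim_null_comparison[OF ev]) (use tendsto_mult_left_zero[OF lim] in simp)
  then show ?thesis
    by (simp add: LIM_zero_iff)
qed

text \<open>Pairing with \<open>y\<close> produces scalar entire functions, so that the scalar
  Liouville theorem applies. By the resolvent identity the difference quotient is itself a resolvent
  term, and its limit follows from strong continuity.\<close>

lemma resolvent_holomorphic:
  assumes R: "\<And>z. R z \<in> bounded_ops" and Q: "Q \<in> bounded_ops"
    and l: "\<And>z x. R z (x - z *\<^sub>C Q x) = x" and r: "\<And>z x. R z x - z *\<^sub>C Q (R z x) = x"
    and S: "S \<in> bounded_ops"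
  shows "(\<lambda>z. cinner (S (R z u)) y) holomorphic_on UNIV"
proof -
  have "((\<lambda>z. cinner (S (R z u)) y) has_field_derivative cinner (S (R w (Q (R w u)))) y) (at w)" for w
  proof -
    have "(cinner (S (R z u)) y - cinner (S (R w u)) y) / (z - w)
        = cinner (S (R z (Q (R w u)))) y" if "z \<noteq> w" for z
    proof -
      \<comment> \<open>The identity is used with \<open>z\<close> and \<open>w\<close> exchanged,
        so that the varying resolvent acts on the fixed vector \<open>Q (R w u)\<close>.\<close>
      have "R z u - R w u = (z - w) *\<^sub>C R z (Q (R w u))"
      proof -
        have "R z u - R w u = - (R w u - R z u)"
          by simp
        also have "\<dots> = - ((w - z) *\<^sub>C R z (Q (R w u)))"
          by (simp only: resolvent_identity[where R = R, OF R l r])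
        also have "\<dots> = (z - w) *\<^sub>C R z (Q (R w u))"
          by (simp add: scaleC_diff_left)
        finally show ?thesis .
      qed
      then have "S (R z u) - S (R w u) = (z - w) *\<^sub>C S (R z (Q (R w u)))"
        by (simp add: bounded_ops_diff[OF S, symmetric] bounded_ops_scaleC[OF S])
      then show ?thesis
        using that by (simp add: cinner_diff_left[symmetric] cinner_scaleC_left)
    qed
    then have ev: "\<forall>\<^sub>F z in at w. cinner (S (R z (Q (R w u)))) y
        = (cinner (S (R z u)) y - cinner (S (R w u)) y) / (z - w)"
      by (simp add: eventually_at_filter)
    have "((\<lambda>z. cinner (S (R z (Q (R w u)))) y) \<longlongrightarrow> cinner (S (R w (Q (R w u)))) y) (at w)"
      by (intro bounded_linear.tendsto[OF bounded_linear_cinner_left]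
          bounded_linear.tendsto[OF bounded_ops_linear[OF S]] resolvent_tendsto[where R = R, OF R Q l r])
    then show ?thesis
      unfolding has_field_derivative_iff by (rule Lim_transform_eventually[OF _ ev])
  qed
  then show ?thesis
    by (meson field_differentiable_def field_differentiable_at_within holomorphic_onI)
qed

section \<open>Vanishing of operators by Liouville's theorem\<close>

lemma tendsto_zero_at_infinity:
  fixes n :: "'a::real_normed_vector \<Rightarrow> real"
  assumes "\<And>z. 0 \<le> n z" and "\<And>z. norm z * n z \<le> d * n z + c"
  shows "(n \<longlongrightarrow> 0) at_infinity"
proof -
  have "\<forall>\<^sub>F z in at_infinity. norm (n z) \<le> 2 * \<bar>c\<bar> * inverse (norm z)"
    unfolding eventually_at_infinity
  proof (intro exI allI impI)
    fix z :: 'a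
    \<comment> \<open>Beyond this threshold \<open>d * n z\<close> is at most half of
      \<open>norm z * n z\<close> and can be absorbed; the summand 1 keeps \<open>norm z\<close>
      positive.\<close>
    assume z: "2 * \<bar>d\<bar> + 1 \<le> norm z"
    have "2 * d * n z \<le> norm z * n z"
      using z assms(1) by (intro mult_right_mono) auto
    then have "norm z * n z \<le> 2 * \<bar>c\<bar>"
      using assms(2)[of z] by linarith
    moreover have "0 < norm z"
      using z by linarith
    ultimately have "n z \<le> 2 * \<bar>c\<bar> / norm z"
      by (simp add: pos_le_divide_eq mult.commute)
    then show "norm (n z) \<le> 2 * \<bar>c\<bar> * inverse (norm z)"
      using assms(1)[of z] by (simp add: divide_inverse)
  qed
  moreover have "((\<lambda>z::'a. 2 * \<bar>c\<bar> * inverse (norm z)) \<longlongrightarrow> 0) at_infinity"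
    by (intro tendsto_mult_right_zero tendsto_inverse_0_at_top filterlim_norm_at_top)
  ultimately show ?thesis
    by (rule Lim_null_comparison)
qed

lemma tendsto_cinner_zero:
  assumes "((\<lambda>z. norm (f z)) \<longlongrightarrow> 0) F"
  shows "((\<lambda>z. cinner (f z) y) \<longlongrightarrow> 0) F"
  using bounded_linear.tendsto_zero[OF bounded_linear_cinner_left tendsto_norm_zero_cancel[OF assms]] .

text \<open>Applying DT to (1 - zQ) \<open>R z x\<close> = x gives z T \<open>R z x\<close> = D T
  \<open>R z x\<close> - D T x. The vector \<open>T (R z x)\<close> therefore decays at infinity,
  Liouville makes it vanish for every \<open>z\<close>, and \<open>R 0\<close> is the
  identity.\<close>

lemma eq_zero_if_eq_comp_quasinilpotent_right:
  assumes D: "D \<in> bounded_ops" and T: "T \<in> bounded_ops" and qn: "quasinilpotent Q"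
    and eq: "\<And>x. T x = D (T (Q x))"
  shows "T x = 0"
proof -
  obtain R where R: "\<And>z. R z \<in> bounded_ops"
    and l: "\<And>z x. R z (x - z *\<^sub>C Q x) = x" and r: "\<And>z x. R z x - z *\<^sub>C Q (R z x) = x"
    by (rule quasinilpotent_resolvent[OF qn]) blast
  have Q: "Q \<in> bounded_ops"
    using qn by (simp add: quasinilpotent_def)
  have step: "z *\<^sub>C T (R z x) = D (T (R z x)) - D (T x)" for z
  proof -
    have "D (T x) = D (T (R z x - z *\<^sub>C Q (R z x)))"
      by (simp add: r)
    also have "\<dots> = D (T (R z x)) - z *\<^sub>C D (T (Q (R z x)))"
      by (simp only: bounded_ops_diff[OF T] bounded_ops_diff[OF D] bounded_ops_scaleC[OF T]
          bounded_ops_scaleC[OF D])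
    finally show ?thesis
      by (simp add: eq[symmetric])
  qed
  have "((\<lambda>z. norm (T (R z x))) \<longlongrightarrow> 0) at_infinity"
  proof (rule tendsto_zero_at_infinity)
    fix z
    have "cmod z * norm (T (R z x)) \<le> norm (D (T (R z x))) + norm (D (T x))"
      by (metis norm_scaleC norm_triangle_ineq4 step)
    also have "\<dots> \<le> onorm D * norm (T (R z x)) + norm (D (T x))"
      by (simp add: bounded_ops_norm_bound[OF D])
    finally show "cmod z * norm (T (R z x)) \<le> onorm D * norm (T (R z x)) + norm (D (T x))" .
  qed simp
  then have "cinner (T (R 0 x)) y = 0" for y
    by (rule Liouville_weak[OF resolvent_holomorphic[where R = R, OF R Q l r T] tendsto_cinner_zero])
  moreover have "R 0 x = x"
    using l[of 0 x] by simp
  ultimately have "cinner (T x) y = cinner 0 y" for y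
    using cinner_scaleC_left[of 0 0 y] by simp
  then show ?thesis
    by (rule cinner_eqI)
qed

text \<open>Here the recursion replaces \<open>x\<close> by \<open>D x\<close>, so an estimate at a
  single vector does not close up. The decay is proved for the operator norm of \<open>R z\<close>
  after \<open>T\<close> and then specialised to \<open>x\<close>.\<close>

lemma eq_zero_if_eq_comp_quasinilpotent_left:
  assumes D: "D \<in> bounded_ops" and T: "T \<in> bounded_ops" and qn: "quasinilpotent Q"
    and eq: "\<And>x. T x = Q (T (D x))"
  shows "T x = 0"
proof -
  obtain R where R: "\<And>z. R z \<in> bounded_ops"
    and l: "\<And>z x. R z (x - z *\<^sub>C Q x) = x" and r: "\<And>z x. R z x - z *\<^sub>C Q (R z x) = x"
    by (rule quasinilpotent_resolvent[OF qn]) blast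
  have Q: "Q \<in> bounded_ops"
    using qn by (simp add: quasinilpotent_def)
  have step: "z *\<^sub>C R z (T x) = R z (T (D x)) - T (D x)" for z x
  proof -
    have "R z (T (D x)) - z *\<^sub>C R z (T x) = R z (T (D x) - z *\<^sub>C Q (T (D x)))"
      by (simp only: bounded_ops_diff[OF R] bounded_ops_scaleC[OF R] eq[symmetric])
    also have "\<dots> = T (D x)"
      by (rule l)
    finally show ?thesis
      by (simp add: algebra_simps)
  qed
  let ?n = "\<lambda>z. onorm (\<lambda>x. R z (T x))"
  have RT: "(\<lambda>x. R z (T x)) \<in> bounded_ops" for z
    by (rule bounded_ops_comp[OF R T])
  have TD: "(\<lambda>x. T (D x)) \<in> bounded_ops"
    by (rule bounded_ops_comp[OF T D])
  have n0: "0 \<le> ?n z" for z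
    by (rule onorm_pos_le[OF bounded_ops_linear[OF RT]])
  have "(?n \<longlongrightarrow> 0) at_infinity"
  proof (rule tendsto_zero_at_infinity)
    fix z
    have "cmod z * norm (R z (T x)) \<le> (onorm D * ?n z + onorm (\<lambda>x. T (D x))) * norm x" for x
    proof -
      have "cmod z * norm (R z (T x)) \<le> norm (R z (T (D x))) + norm (T (D x))"
        by (metis norm_scaleC norm_triangle_ineq4 step)
      also have "norm (R z (T (D x))) \<le> ?n z * norm (D x)"
        by (rule bounded_ops_norm_bound[OF RT])
      also have "?n z * norm (D x) \<le> ?n z * (onorm D * norm x)"
        by (rule mult_left_mono[OF bounded_ops_norm_bound[OF D] n0])
      also have "norm (T (D x)) \<le> onorm (\<lambda>x. T (D x)) * norm x"
        by (rule bounded_ops_norm_bound[OF TD])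
      finally show ?thesis
        by (simp add: algebra_simps)
    qed
    then have "norm (z *\<^sub>C R z (T x)) \<le> (onorm D * ?n z + onorm (\<lambda>x. T (D x))) * norm x" for x
      by (simp add: norm_scaleC)
    then have "onorm (\<lambda>x. z *\<^sub>C R z (T x)) \<le> onorm D * ?n z + onorm (\<lambda>x. T (D x))"
      by (intro onorm_bound add_nonneg_nonneg mult_nonneg_nonneg n0
          onorm_pos_le[OF bounded_ops_linear[OF D]] onorm_pos_le[OF bounded_ops_linear[OF TD]])
    moreover have "cmod z * ?n z \<le> onorm (\<lambda>x. z *\<^sub>C R z (T x))"
    proof (cases "z = 0")
      case True
      then show ?thesis
        by (simp add: onorm_zero)
    next
      case False
      have "norm (R z (T x)) \<le> onorm (\<lambda>x. z *\<^sub>C R z (T x)) / cmod z * norm x" for x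
        using bounded_ops_norm_bound[OF bounded_ops_scale[OF RT], of z z x] False
        by (simp add: norm_scaleC field_simps)
      then have "?n z \<le> onorm (\<lambda>x. z *\<^sub>C R z (T x)) / cmod z"
        by (intro onorm_bound divide_nonneg_nonneg
            onorm_pos_le[OF bounded_ops_linear[OF bounded_ops_scale[OF RT]]]) simp
      then show ?thesis
        using False by (simp add: field_simps)
    qed
    ultimately show "cmod z * ?n z \<le> onorm D * ?n z + onorm (\<lambda>x. T (D x))"
      by linarith
  qed (rule n0)
  then have "((\<lambda>z. ?n z * norm x) \<longlongrightarrow> 0) at_infinity"
    by (rule tendsto_mult_left_zero)
  then have "((\<lambda>z. norm (R z (T x))) \<longlongrightarrow> 0) at_infinity"
    by (rule Lim_null_comparison[rotated]) (simp add: bounded_ops_norm_bound[OF RT])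
  then have "cinner (R 0 (T x)) y = 0" for y
    by (rule Liouville_weak[OF resolvent_holomorphic[where R = R, OF R Q l r bounded_ops_id]
          tendsto_cinner_zero])
  moreover have "R 0 (T x) = T x"
    using l[of 0 "T x"] by simp
  ultimately have "cinner (T x) y = cinner 0 y" for y
    using cinner_scaleC_left[of 0 0 y] by simp
  then show ?thesis
    by (rule cinner_eqI)
qed

section \<open>Uniqueness of the generalized Drazin inverse\<close>

text \<open>Both AD1(1 - AD2) and (1 - AD1)AD2 vanish, so the idempotents AD1 and AD2 coincide with
  their product AD1AD2. Commutation of D1 with D2 is not assumed, hence the separate left and right
  arguments.\<close>

lemma is_gdrazin_inverse_unique:
  assumes A: "A \<in> bounded_ops" and "is_gdrazin_inverse A D1" and "is_gdrazin_inverse A D2"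
  shows "D1 = D2"
proof -
  have D: "D1 \<in> bounded_ops" "D2 \<in> bounded_ops"
    and c: "D1 (A x) = A (D1 x)" "D2 (A x) = A (D2 x)"
    and ADD: "A (D1 (D1 x)) = D1 x" "A (D2 (D2 x)) = D2 x"
    and qn: "quasinilpotent (\<lambda>x. A x - A (A (D1 x)))" "quasinilpotent (\<lambda>x. A x - A (A (D2 x)))" for x
    using assms(2,3) unfolding is_gdrazin_inverse_def by (auto simp: fun_eq_iff)
  \<comment> \<open>The rules \<open>c\<close> move every \<open>A\<close> to the front; these
    equations let it still cancel against an inner square.\<close>
  have ADDD: "A (D1 (D2 (D2 x))) = D1 (D2 x)" "A (D2 (D1 (D1 x))) = D2 (D1 x)" for x
    by (metis ADD c)+
  have AD: "(\<lambda>x. A (D1 x)) \<in> bounded_ops" "(\<lambda>x. A (D2 x)) \<in> bounded_ops"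
    by (rule bounded_ops_comp[OF A D(1)], rule bounded_ops_comp[OF A D(2)])
  note AD = AD bounded_ops_comp[OF AD(1) AD(2)]
  note simps = bounded_ops_diff[OF A] bounded_ops_diff[OF D(1)] bounded_ops_diff[OF D(2)] c ADD ADDD
    bounded_ops_zero[OF A] bounded_ops_zero[OF D(1)] bounded_ops_zero[OF D(2)]
  have "A (D1 x) - A (D1 (A (D2 x))) = 0" for x
    by (rule eq_zero_if_eq_comp_quasinilpotent_right[OF D(1) _ qn(2),
          where T = "\<lambda>x. A (D1 x) - A (D1 (A (D2 x)))"])
      (intro bounded_ops_sub AD, simp add: simps)
  moreover have "A (D2 x) - A (D1 (A (D2 x))) = 0" for x
    by (rule eq_zero_if_eq_comp_quasinilpotent_left[OF D(2) _ qn(1),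
          where T = "\<lambda>x. A (D2 x) - A (D1 (A (D2 x)))"])
      (intro bounded_ops_sub AD, simp add: simps)
  ultimately have P: "A (D1 x) = A (D2 x)" for x
    by (metis eq_iff_diff_eq_0)
  \<comment> \<open>D1 = D1(AD1) = D1(AD2) = (AD1)D2 = (AD2)D2 = D2.\<close>
  have "D1 x = D2 x" for x
    by (metis ADD P c)
  then show ?thesis
    by blast
qed

lemma gdrazin_inverse_eq:
  assumes "A \<in> bounded_ops" and "is_gdrazin_inverse A D"
  shows "gdrazin_inverse A = D"
  unfolding gdrazin_inverse_def
proof (rule the_equality)
  show "is_gdrazin_inverse A D"
    by (rule assms(2))
  show "D' = D" if "is_gdrazin_inverse A D'" for D'
    by (rule is_gdrazin_inverse_unique[OF assms(1) that assms(2)])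
qed

section \<open>Projectors\<close>

text \<open>Hilbert's projection theorem: a minimising sequence for the distance to \<open>L\<close>
  is Cauchy, and its limit \<open>p\<close> is a minimiser, which forces orthogonality.\<close>

lemma closest_point_in_subspace:
  fixes L :: "'a::{real_inner, banach} set"
  assumes L: "subspace L" and cl: "closed L"
  obtains p where "p \<in> L" "\<And>q. q \<in> L \<Longrightarrow> inner (x - p) q = 0"
proof -
  define d where "d = Inf ((\<lambda>q. (norm (x - q))\<^sup>2) ` L)"
  have L0: "0 \<in> L"
    using L by (rule subspace_0)
  have lower: "d \<le> (norm (x - q))\<^sup>2" if "q \<in> L" for q
    unfolding d_def by (rule cInf_lower) (use that in \<open>auto intro: bdd_belowI[of _ 0]\<close>)
  have "\<exists>q\<in>L. (norm (x - q))\<^sup>2 < d + e" if "0 < e" for e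
    using cInf_lessD[of "(\<lambda>q. (norm (x - q))\<^sup>2) ` L" "d + e"] L0 that
    by (auto simp: d_def)
  then have "\<forall>n. \<exists>q. q \<in> L \<and> (norm (x - q))\<^sup>2 < d + inverse (real (Suc n))"
    by (meson inverse_positive_iff_positive of_nat_0_less_iff zero_less_Suc)
  then obtain s where s: "\<And>n. s n \<in> L" "\<And>n. (norm (x - s n))\<^sup>2 < d + inverse (real (Suc n))"
    by metis
  have near: "(norm (s m - s n))\<^sup>2 \<le> 2 * inverse (real (Suc m)) + 2 * inverse (real (Suc n))" for m n
  proof -
    have mid: "(1 / 2) *\<^sub>R (s m + s n) \<in> L"
      using L s by (simp add: subspace_add subspace_scale)
    \<comment> \<open>Parallelogram law for \<open>x - s m\<close> and \<open>x - s n\<close>. The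
      midpoint lies in \<open>L\<close>, so its squared distance from \<open>x\<close> is at least
      \<open>d\<close>.\<close>
    have "(norm (s m - s n))\<^sup>2 + 4 * (norm (x - (1 / 2) *\<^sub>R (s m + s n)))\<^sup>2
        = 2 * (norm (x - s m))\<^sup>2 + 2 * (norm (x - s n))\<^sup>2"
      by (simp add: power2_norm_eq_inner inner_diff_left inner_diff_right inner_add_left
          inner_add_right inner_commute algebra_simps)
    then show ?thesis
      using lower[OF mid] s(2)[of m] s(2)[of n] by linarith
  qed
  have "Cauchy s"
  proof (rule metric_CauchyI)
    fix e :: real
    assume "0 < e"
    then obtain N where N: "inverse (real (Suc N)) < e\<^sup>2 / 4"
      using reals_Archimedean[of "e\<^sup>2 / 4"] by auto
    have "dist (s m) (s n) < e" if "N \<le> m" "N \<le> n" for m n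
    proof -
      have "inverse (real (Suc m)) \<le> inverse (real (Suc N))" "inverse (real (Suc n)) \<le> inverse (real (Suc N))"
        using that by (auto intro: le_imp_inverse_le)
      then have "(norm (s m - s n))\<^sup>2 < e\<^sup>2"
        using near[of m n] N by linarith
      then show ?thesis
        using \<open>0 < e\<close> by (simp add: dist_norm power2_less_imp_less)
    qed
    then show "\<exists>N. \<forall>m\<ge>N. \<forall>n\<ge>N. dist (s m) (s n) < e"
      by blast
  qed
  then obtain p where p: "s \<longlonglongrightarrow> p"
    using Cauchy_convergent convergent_def by blast
  have pL: "p \<in> L"
    using closed_sequentially[OF cl _ p] s by blast
  have "(\<lambda>n. (norm (x - s n))\<^sup>2) \<longlonglongrightarrow> (norm (x - p))\<^sup>2"
    by (intro tendsto_intros p)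
  moreover have "(\<lambda>n. d + inverse (real (Suc n))) \<longlonglongrightarrow> d"
    using tendsto_add[OF tendsto_const LIMSEQ_inverse_real_of_nat] by simp
  ultimately have pd: "(norm (x - p))\<^sup>2 \<le> d"
    by (rule LIMSEQ_le) (use s(2) less_imp_le in blast)
  have "inner (x - p) q = 0" if q: "q \<in> L" for q
  proof (cases "q = 0")
    case False
    \<comment> \<open>The minimiser of the norm of (x - p) - tq over real t. It lowers the squared
      distance by \<open>(inner (x - p) q)\<^sup>2 / inner q q\<close>, which minimality of
      \<open>p\<close> forces to be zero.\<close>
    define t where "t = inner (x - p) q / inner q q"
    have qq: "0 < inner q q"
      using False by simp
    have "p + t *\<^sub>R q \<in> L"
      using L pL q by (simp add: subspace_add subspace_scale)
    then have "(norm (x - p))\<^sup>2 \<le> (norm ((x - p) - t *\<^sub>R q))\<^sup>2"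
      using order_trans[OF pd lower] by (simp only: diff_diff_eq)
    also have "\<dots> = (norm (x - p))\<^sup>2 - 2 * t * inner (x - p) q + t * t * inner q q"
      unfolding power2_norm_eq_inner
      by (simp only: inner_diff_left[of "x - p" "t *\<^sub>R q"] inner_diff_right[of _ "x - p" "t *\<^sub>R q"]
          inner_scaleR_left inner_scaleR_right inner_commute[of q "x - p"]) (simp add: algebra_simps)
    also have "\<dots> = (norm (x - p))\<^sup>2 - (inner (x - p) q)\<^sup>2 / inner q q"
      using qq by (simp add: t_def field_simps power2_eq_square)
    finally have "(inner (x - p) q)\<^sup>2 \<le> 0"
      using qq by (simp add: field_simps)
    then show ?thesis
      by simp
  qed simp
  with pL show ?thesis
    using that by blast
qed

text \<open>Evaluates the definite description: the nearest-point map satisfies it, and a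
  self-adjoint idempotent is determined by its range.\<close>

lemma orth_projector_props:
  fixes L :: "'a::complex_hilbert_space set"
  assumes L: "subspace L" and sc: "\<And>c x. x \<in> L \<Longrightarrow> c *\<^sub>C x \<in> L" and cl: "closed L"
  shows "orth_projector L \<in> bounded_ops" and "range (orth_projector L) = L"
    and "\<And>x. x \<in> L \<Longrightarrow> orth_projector L x = x"
proof -
  have "\<exists>p. p \<in> L \<and> (\<forall>q\<in>L. inner (x - p) q = 0)" for x
    by (rule closest_point_in_subspace[OF L cl, of x]) blast
  then obtain P where PL: "\<And>x. P x \<in> L" and Pi: "\<And>x q. q \<in> L \<Longrightarrow> inner (x - P x) q = 0"
    by metis
  have uniq: "P x = p" if "p \<in> L" "\<And>q. q \<in> L \<Longrightarrow> inner (x - p) q = 0" for x p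
  proof -
    have "P x - p \<in> L"
      using L PL that by (simp add: subspace_diff)
    then have "inner (x - p) (P x - p) - inner (x - P x) (P x - p) = 0"
      using that(2) Pi by simp
    then have "inner (P x - p) (P x - p) = 0"
      by (simp add: inner_diff_left)
    then show ?thesis
      by simp
  qed
  \<comment> \<open>Real orthogonality to both q and iq, the latter in \<open>L\<close> by
    \<open>sc\<close>, is complex orthogonality.\<close>
  have Pc: "cinner (x - P x) q = 0" if "q \<in> L" for x q
    using Pi that sc by (simp add: cinner_eq_inner Complex_eq_0)
  have P_bdd: "P \<in> bounded_ops"
  proof (rule bounded_opsI[where K = 1])
    show "P (x + y) = P x + P y" for x y
    proof (rule uniq)
      show "P x + P y \<in> L"
        using L PL by (simp add: subspace_add)
      show "inner (x + y - (P x + P y)) q = 0" if "q \<in> L" for q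
        using Pi[OF that, of x] Pi[OF that, of y]
        by (simp add: inner_diff_left inner_add_left)
    qed
    show "P (c *\<^sub>C x) = c *\<^sub>C P x" for c x
    proof (rule uniq)
      show "c *\<^sub>C P x \<in> L"
        by (rule sc[OF PL])
      show "inner (c *\<^sub>C x - c *\<^sub>C P x) q = 0" if "q \<in> L" for q
        using Pc[OF that, of x]
        by (simp add: inner_eq_Re_cinner scaleC_diff_right[symmetric] cinner_scaleC_left)
    qed
    show "norm (P x) \<le> norm x * 1" for x
    proof -
      have "(norm x)\<^sup>2 = (norm (x - P x))\<^sup>2 + (norm (P x))\<^sup>2"
        using Pi[OF PL, of x x]
        by (simp add: power2_norm_eq_inner inner_diff_left inner_diff_right inner_commute)
      then have "(norm (P x))\<^sup>2 \<le> (norm x)\<^sup>2"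
        by simp
      then have "norm (P x) \<le> norm x"
        by (rule power2_le_imp_le) simp
      then show ?thesis
        by simp
    qed
  qed
  have Pid: "P x = x" if "x \<in> L" for x
    by (rule uniq) (use that in auto)
  have Pr: "range P = L"
    using PL Pid by (metis image_subset_iff subset_antisym subsetI rangeI)
  have half: "cinner (P x) y = cinner (P x) (P y)" for x y
  proof -
    have "cinner (y - P y) (P x) = 0"
      by (rule Pc[OF PL])
    then have "cinner y (P x) = cinner (P y) (P x)"
      by (simp add: cinner_diff_left)
    then show ?thesis
      by (metis cinner_commute)
  qed
  then have sa: "cinner (P x) y = cinner x (P y)" for x y
    by (metis cinner_commute)
  have "orth_projector L = P"
    unfolding orth_projector_def
  proof (rule the_equality)
    show "P \<in> bounded_ops \<and> P \<circ> P = P \<and> range P = L \<and> (\<forall>x y. cinner (P x) y = cinner x (P y))"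
      using P_bdd Pr sa Pid PL by (auto simp: fun_eq_iff)
    fix S
    assume S: "S \<in> bounded_ops \<and> S \<circ> S = S \<and> range S = L \<and> (\<forall>x y. cinner (S x) y = cinner x (S y))"
    have SL: "S x \<in> L" for x
      using S by blast
    have "S (S x) = S x" for x
      using S by (metis comp_apply)
    then have SP: "S (P x) = P x" for x
      using S PL by (metis imageE)
    have PS: "P (S x) = S x" for x
      by (rule Pid[OF SL])
    \<comment> \<open>Equal ranges give PS = S and SP = P; taking adjoints in the first gives SP =
      S, whence S = P.\<close>
    have "cinner (S x) y = cinner (P x) y" for x y
    proof -
      have "cinner (S x) y = cinner (P (S x)) y"
        by (simp add: PS)
      also have "\<dots> = cinner x (S (P y))"
        using S sa by metis
      finally show ?thesis
        by (simp add: SP sa)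
    qed
    then show "S = P"
      by (intro ext cinner_eqI)
  qed
  with P_bdd Pr Pid show "orth_projector L \<in> bounded_ops" "range (orth_projector L) = L"
    "\<And>x. x \<in> L \<Longrightarrow> orth_projector L x = x"
    by simp_all
qed

text \<open>The splitting x = Px + (x - Px) into range and null space determines an idempotent, so
  the definite description returns \<open>P\<close>.\<close>

lemma projector_eqI:
  assumes P: "P \<in> bounded_ops" and idem: "\<And>x. P (P x) = P x"
  shows "projector (range P) (null_space P) = P"
  unfolding projector_def
proof (rule the_equality)
  show "P \<in> bounded_ops \<and> P \<circ> P = P \<and> range P = range P \<and> null_space P = null_space P"
    using assms by (auto simp: fun_eq_iff)
  fix S
  assume S: "S \<in> bounded_ops \<and> S \<circ> S = S \<and> range S = range P \<and> null_space S = null_space P"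
  have "S x = P x" for x
  proof -
    have "x - P x \<in> null_space P"
      using assms by (simp add: null_space_def bounded_ops_diff)
    then have "S (x - P x) = 0"
      using S by (auto simp: null_space_def)
    then have "S x = S (P x)"
      using S by (simp add: bounded_ops_diff)
    moreover have "P x \<in> range S"
      using S by simp
    then have "S (P x) = P x"
      using S by (metis comp_apply imageE)
    ultimately show ?thesis
      by simp
  qed
  then show "S = P"
    by blast
qed

section \<open>The core-EP inverse\<close>

locale gdrazin_pair =
  fixes A D :: "'a::complex_hilbert_space \<Rightarrow> 'a"
  assumes A: "A \<in> bounded_ops" and gdrazin: "is_gdrazin_inverse A D"
begin

lemma D: "D \<in> bounded_ops"
  and D_A: "D (A x) = A (D x)"
  and A_D_D: "A (D (D x)) = D x"
  using gdrazin unfolding is_gdrazin_inverse_def by (auto simp: fun_eq_iff)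

lemma A_D_range: "x \<in> range D \<Longrightarrow> A (D x) = x"
  using A_D_D by auto

text \<open>The range of \<open>D\<close> is the fixed-point set of the continuous map AD.
  Closedness makes the orthogonal projector onto it meaningful.\<close>

lemma range_D_closed: "closed (range D)"
proof -
  have "range D = {x. A (D x) = x}"
    using A_D_range D_A by (auto simp: image_iff) metis
  moreover have "closed {x. A (D x) = x}"
    by (intro closed_Collect_eq continuous_intros bounded_linear.continuous_on[OF bounded_ops_linear[OF A]]
        bounded_linear.continuous_on[OF bounded_ops_linear[OF D]])
  ultimately show ?thesis
    by simp
qed

abbreviation P :: "'a \<Rightarrow> 'a" where
  "P \<equiv> orth_projector (range D)"

lemma P: "P \<in> bounded_ops"
  and P_range: "P x \<in> range D"
  and P_fix: "x \<in> range D \<Longrightarrow> P x = x"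
proof -
  have sub: "subspace (range D)"
    using linear_subspace_image[OF bounded_linear.linear[OF bounded_ops_linear[OF D]] subspace_UNIV] .
  have sc: "c *\<^sub>C x \<in> range D" if "x \<in> range D" for c x
    using that by (auto simp: bounded_ops_scaleC[OF D, symmetric])
  note props = orth_projector_props[OF sub sc range_D_closed]
  show "P \<in> bounded_ops" "P x \<in> range D" "x \<in> range D \<Longrightarrow> P x = x"
    using props by blast+
qed

text \<open>DA = AD is the identity on the range of \<open>D\<close>. This gives uniqueness both for
  the core-EP inverse and for the final system.\<close>

lemma recover_from_A_comp:
  assumes "range B \<subseteq> range D"
  shows "B x = D (A (B x))"
  using assms by (metis A_D_range D_A rangeI subsetD)

lemma core_ep_inverse_eq: "core_ep_inverse A = (\<lambda>x. D (P x))"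
  unfolding core_ep_inverse_def gdrazin_inverse_eq[OF A gdrazin]
proof (rule the_equality)
  show "(\<lambda>x. D (P x)) \<in> bounded_ops \<and> A \<circ> (\<lambda>x. D (P x)) = P \<and> range (\<lambda>x. D (P x)) \<subseteq> range D"
    using bounded_ops_comp[OF D P] A_D_range[OF P_range] by (auto simp: fun_eq_iff)
  show "B = (\<lambda>x. D (P x))" if "B \<in> bounded_ops \<and> A \<circ> B = P \<and> range B \<subseteq> range D" for B
    using that recover_from_A_comp by (metis comp_apply)
qed

lemma P_D: "P (D x) = D x"
  by (simp add: P_fix)

text \<open>With E = DP, the operator EA = DPA maps into the range of \<open>D\<close> and fixes it
  pointwise, so it is idempotent with exactly that range.\<close>

lemma projector_core_ep:
  "projector (range D) (null_space (core_ep_inverse A \<circ> A)) = (\<lambda>x. D (P (A x)))"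
proof -
  have fixpt: "D (P (A (D x))) = D x" for x
    \<comment> \<open>The first call turns \<open>A (D x)\<close> into \<open>D (A x)\<close>,
      exposing a vector that \<open>P\<close> fixes; the second moves \<open>A\<close> back
      out.\<close>
    by (simp add: D_A[symmetric] P_D) (simp add: D_A A_D_D)
  have "range (\<lambda>x. D (P (A x))) = range D"
  proof
    show "range D \<subseteq> range (\<lambda>x. D (P (A x)))"
    proof (rule image_subsetI)
      show "D x \<in> range (\<lambda>x. D (P (A x)))" for x
        by (rule range_eqI[where x = "D x"]) (simp only: fixpt)
    qed
  qed blast
  with fixpt show ?thesis
    using projector_eqI[of "\<lambda>x. D (P (A x))"] bounded_ops_comp[OF D bounded_ops_comp[OF P A]]
    by (simp add: core_ep_inverse_eq comp_def)
qed

end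

theorem corollary2p2:
  fixes A :: "'a::complex_hilbert_space \<Rightarrow> 'a"
  assumes "infinite_dimensional TYPE('a)"
    and "A \<in> bounded_ops"
    and "gdrazin_invertible A"
  shows "{B \<in> bounded_ops.
            A \<circ> B = projector (range (gdrazin_inverse A)) (null_space (core_ep_inverse A \<circ> A)) \<and>
            range B \<subseteq> range (gdrazin_inverse A)}
         = {core_ep_inverse A \<circ> core_ep_inverse A \<circ> A}"
proof -
  obtain D where "is_gdrazin_inverse A D"
    using assms(3) by (auto simp: gdrazin_invertible_def)
  then interpret gdrazin_pair A D
    using assms(2) by unfold_locales
  have EEA: "core_ep_inverse A \<circ> core_ep_inverse A \<circ> A = (\<lambda>x. D (D (P (A x))))"
    by (simp add: fun_eq_iff core_ep_inverse_eq P_D)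
  have "{B \<in> bounded_ops. A \<circ> B = (\<lambda>x. D (P (A x))) \<and> range B \<subseteq> range D}
      = {\<lambda>x. D (D (P (A x)))}" (is "?S = {?B}")
  proof
    have "?B \<in> bounded_ops"
      by (rule bounded_ops_comp[OF D bounded_ops_comp[OF D bounded_ops_comp[OF P A]]])
    \<comment> \<open>Existence: ADD = D gives A(DDPA) = DPA.\<close>
    then show "{?B} \<subseteq> ?S"
      by (auto simp: fun_eq_iff A_D_D)
    \<comment> \<open>Uniqueness: B = D(AB) = D(DPA) for every solution.\<close>
    show "?S \<subseteq> {?B}"
    proof
      fix B
      assume B: "B \<in> ?S"
      then have "A (B x) = D (P (A x))" for x
        by (auto simp: fun_eq_iff)
      moreover have "B x = D (A (B x))" for x
        using B by (intro recover_from_A_comp) auto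
      ultimately show "B \<in> {?B}"
        by auto
    qed
  qed
  then show ?thesis
    by (simp only: EEA gdrazin_inverse_eq[OF A gdrazin] projector_core_ep)
qed

end
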